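(* Let $H$ be a finite simple graph that properly contains a triangle, i.e. $K_3$ is a subgraph of $H$ and $e(H)>3$. Then $H$ is not strongly common.
   Context: A kernel is a bounded measurable symmetric function $U:[0,1]^2\to\mathbb{R}$. For a graph $H$ with vertex set $\{1,\dots,v(H)\}$, the homomorphism density is $t_H(U)=\int_{[0,1]^{v(H)}}\prod_{ij\in E(H)}U(x_i,x_j)\,dx_1\cdots dx_{v(H)}$. A graph $H$ is strongly common if $t_H(W)+t_H(1-W)\ge t_{K_2}(W)^{e(H)}+t_{K_2}(1-W)^{e(H)}$ for every kernel $W:[0,1]^2\to[0,1]$. Here $e(H)$ denotes the number of edges and $v(H)$ the number of vertices of $H$. *)

theory Defs
  imports "HOL-Analysis.Analysis"
begin

record graph =
  num_verts :: nat
  edges :: "nat set set"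

definition verts :: "graph \<Rightarrow> nat set" where
  "verts H = {1..num_verts H}"

definition num_edges :: "graph \<Rightarrow> nat" where
  "num_edges H = card (edges H)"

definition simple_graph :: "graph \<Rightarrow> bool" where
  "simple_graph H \<longleftrightarrow> (\<forall>f\<in>edges H. f \<subseteq> verts H \<and> card f = 2)"

definition complete_graph :: "nat \<Rightarrow> graph" where
  "complete_graph n = \<lparr>num_verts = n, edges = {f. f \<subseteq> {1..n} \<and> card f = 2}\<rparr>"

text \<open>Being a subgraph is understood up to isomorphism, and the copy need not be induced.\<close>

definition subgraph_of :: "graph \<Rightarrow> graph \<Rightarrow> bool" where
  "subgraph_of G H \<longleftrightarrow>
     (\<exists>\<phi>. inj_on \<phi> (verts G) \<and> \<phi> ` verts G \<subseteq> verts H \<and> (\<forall>f\<in>edges G. \<phi> ` f \<in> edges H))"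

text \<open>Kernels are Lebesgue measurable. Only the values on the unit square matter.\<close>

definition kernel :: "(real \<times> real \<Rightarrow> real) \<Rightarrow> bool" where
  "kernel U \<longleftrightarrow>
     bounded (U ` ({0..1} \<times> {0..1})) \<and>
     U \<in> borel_measurable (lebesgue_on ({0..1} \<times> {0..1})) \<and>
     (\<forall>x\<in>{0..1}. \<forall>y\<in>{0..1}. U (x, y) = U (y, x))"

text \<open>
  Lebesgue measure on the cube \<open>[0,1]\<^sup>I\<close>. The completion is needed because a finite product of
  Lebesgue measures is not complete, so the integrand below may fail to be measurable for the
  bare product when the kernel is not Borel.
\<close>

definition cube_measure :: "nat set \<Rightarrow> (nat \<Rightarrow> real) measure" where
  "cube_measure I = completion (Pi\<^sub>M I (\<lambda>_. restrict_space lborel {0..1}))"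

text \<open>
  Each edge is listed once, with its smaller endpoint first; by symmetry of \<open>U\<close> the order
  of the endpoints is irrelevant.
\<close>

definition hom_density :: "graph \<Rightarrow> (real \<times> real \<Rightarrow> real) \<Rightarrow> real" where
  "hom_density H U =
     (\<integral>x. (\<Prod>(i, j)\<in>{(i, j). i < j \<and> {i, j} \<in> edges H}. U (x i, x j)) \<partial>cube_measure (verts H))"

definition strongly_common :: "graph \<Rightarrow> bool" where
  "strongly_common H \<longleftrightarrow>
     (\<forall>W. kernel W \<and> W ` ({0..1} \<times> {0..1}) \<subseteq> {0..1} \<longrightarrow>
        hom_density H W + hom_density H (\<lambda>p. 1 - W p) \<ge>
        hom_density (complete_graph 2) W ^ num_edges H +
        hom_density (complete_graph 2) (\<lambda>p. 1 - W p) ^ num_edges H)"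

end

(*
  Perturb the constant kernel 1/4 by \<epsilon> s(x) s(y), where s = 1 on [0,1/2) and s = -1 on [1/2,1].
  Expanding the product over the edges, a set F of edges contributes to the density only if every
  vertex has even degree in F, so no F with one or two edges does. The leading term of the deviation
  from the constant kernel thus comes from the triangles and is a positive multiple of
  \<epsilon>^3 ((1/4)^(e-3) - (3/4)^(e-3)), which is negative as e > 3. On the other side of the inequality
  the edge density stays equal to 1/4.
*)
theory Submission
  imports Defs "HOL-Probability.Probability_Measure"
begin

section \<open>Edges as ordered pairs, parity of degrees, and the two-valued kernel\<close>

definition edge_pairs :: "graph \<Rightarrow> (nat \<times> nat) set" where
  "edge_pairs H = {(i, j). i < j \<and> {i, j} \<in> edges H}"

definition degree_in :: "(nat \<times> nat) set \<Rightarrow> nat \<Rightarrow> nat" where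
  "degree_in F v = card {e \<in> F. v = fst e \<or> v = snd e}"

text \<open>These sets form the cycle space of the graph over the field with two elements.\<close>

definition even_edge_set :: "nat set \<Rightarrow> (nat \<times> nat) set \<Rightarrow> bool" where
  "even_edge_set V F \<longleftrightarrow> (\<forall>v\<in>V. even (degree_in F v))"

definition half_sign :: "real \<Rightarrow> real" where
  "half_sign x = (if x < 1/2 then 1 else -1)"

text \<open>A step function: \<open>p + c\<close> on the two diagonal quarters of the unit square,
  \<open>p - c\<close> on the other two. The family is closed under complement, which turns
  \<open>p\<close> into \<open>1 - p\<close> and \<open>c\<close> into \<open>- c\<close>.\<close>

definition block_kernel :: "real \<Rightarrow> real \<Rightarrow> real \<times> real \<Rightarrow> real" where
  "block_kernel p c z = p + c * (half_sign (fst z) * half_sign (snd z))"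

lemma edge_pairs_verts:
  assumes "simple_graph H" "(i, j) \<in> edge_pairs H"
  shows "i \<in> verts H" "j \<in> verts H" "i < j"
  using assms by (auto simp: edge_pairs_def simple_graph_def)

lemma finite_edge_pairs:
  assumes "simple_graph H" shows "finite (edge_pairs H)"
proof (rule finite_subset)
  show "edge_pairs H \<subseteq> verts H \<times> verts H"
    using edge_pairs_verts[OF assms] by auto
qed (simp add: verts_def)

lemma card_edge_pairs:
  assumes "simple_graph H" shows "card (edge_pairs H) = num_edges H"
proof -
  have "bij_betw (\<lambda>(i, j). {i, j}) (edge_pairs H) (edges H)"
  proof (rule bij_betw_imageI)
    show "inj_on (\<lambda>(i, j). {i, j}) (edge_pairs H)"
      by (auto simp: inj_on_def edge_pairs_def doubleton_eq_iff)
    show "(\<lambda>(i, j). {i, j}) ` edge_pairs H = edges H"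
    proof (intro equalityI subsetI)
      fix e assume e: "e \<in> edges H"
      then have "card e = 2" using assms by (auto simp: simple_graph_def)
      then obtain i j where ij: "e = {i, j}" "i \<noteq> j" by (auto simp: card_2_iff)
      then have "(i, j) \<in> edge_pairs H \<or> (j, i) \<in> edge_pairs H"
        using e by (cases "i < j") (auto simp: edge_pairs_def insert_commute)
      then show "e \<in> (\<lambda>(i, j). {i, j}) ` edge_pairs H"
        using ij by (force simp: insert_commute)
    qed (auto simp: edge_pairs_def)
  qed
  then show ?thesis by (simp add: num_edges_def bij_betw_same_card)
qed

section \<open>Moments of the sign function\<close>

lemma half_sign_borel [measurable]: "half_sign \<in> borel_measurable borel"
  unfolding half_sign_def by measurable

lemma half_sign_power: "half_sign x ^ n = (if even n then 1 else half_sign x)"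
  by (auto simp: half_sign_def)

lemma abs_half_sign: "\<bar>half_sign x\<bar> = 1"
  by (simp add: half_sign_def)

lemma prob_space_unit_interval: "prob_space (restrict_space lborel {0..1::real})"
  by (rule prob_spaceI) (simp add: emeasure_restrict_space space_restrict_space)

lemma integral_half_sign: "(\<integral>x. half_sign x \<partial>restrict_space lborel {0..1}) = 0"
proof -
  have fin: "emeasure lborel {0..<1/2::real} < \<infinity>" "emeasure lborel {1/2..1::real} < \<infinity>"
    by (rule emeasure_bounded_finite, force)+
  have "(\<integral>x. half_sign x \<partial>restrict_space lborel {0..1})
      = (\<integral>x. indicator {0..1} x *\<^sub>R half_sign x \<partial>lborel)"
    by (subst integral_restrict_space) auto
  \<comment> \<open>The two intervals partition [0,1], so this identity holds at every point; both
    have length 1/2.\<close>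
  also have "(\<lambda>x. indicator {0..1} x *\<^sub>R half_sign x)
      = (\<lambda>x. indicator {0..<1/2::real} x - indicator {1/2..1} x)"
    by (auto simp: half_sign_def indicator_def fun_eq_iff)
  also have "(\<integral>x. indicator {0..<1/2::real} x - indicator {1/2..1} x \<partial>lborel) = (0::real)"
    by (subst Bochner_Integration.integral_diff) (use fin in \<open>auto intro: integrable_real_indicator\<close>)
  finally show ?thesis .
qed

lemma integral_half_sign_power:
  "(\<integral>x. half_sign x ^ n \<partial>restrict_space lborel {0..1}) = (if even n then 1 else 0)"
proof -
  interpret prob_space "restrict_space lborel {0..1::real}" by (rule prob_space_unit_interval)
  show ?thesis by (simp add: half_sign_power integral_half_sign prob_space[simplified])
qed

lemma integrable_half_sign_power:
  "integrable (restrict_space lborel {0..1}) (\<lambda>x. half_sign x ^ n)"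
proof -
  interpret prob_space "restrict_space lborel {0..1::real}" by (rule prob_space_unit_interval)
  show ?thesis
    by (rule integrable_const_bound[of _ 1])
       (auto simp: power_abs abs_half_sign intro!: measurable_restrict_space1)
qed

section \<open>Expansion of the density over edge sets\<close>

text \<open>Double counting of incidences: the sign of \<open>v\<close> occurs once for every edge
  of \<open>F\<close> at \<open>v\<close>.\<close>

lemma prod_half_sign_edges:
  assumes "finite F" "finite V" "\<And>i j. (i, j) \<in> F \<Longrightarrow> i \<in> V \<and> j \<in> V \<and> i \<noteq> j"
  shows "(\<Prod>(i, j)\<in>F. half_sign (x i) * half_sign (x j))
       = (\<Prod>v\<in>V. half_sign (x v) ^ degree_in F v)"
proof -
  let ?s = "\<lambda>v. half_sign (x v)"
  \<comment> \<open>Padding each edge factor with ones to a product over all of \<open>V\<close>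
    lets the two products be swapped.\<close>
  have "(\<Prod>(i, j)\<in>F. ?s i * ?s j)
      = (\<Prod>e\<in>F. \<Prod>v\<in>V. if v = fst e \<or> v = snd e then ?s v else 1)"
  proof (rule prod.cong[OF refl])
    fix e assume e: "e \<in> F"
    obtain i j where ij: "e = (i, j)" by force
    have *: "i \<in> V" "j \<in> V" "i \<noteq> j" using assms(3) e ij by auto
    then have "(\<Prod>v\<in>V. if v = i \<or> v = j then ?s v else 1) = prod ?s {v \<in> V. v = i \<or> v = j}"
      using assms(2) by (intro prod.inter_filter[symmetric])
    also have "{v \<in> V. v = i \<or> v = j} = {i, j}" using * by auto
    finally show "(case e of (i, j) \<Rightarrow> ?s i * ?s j)
      = (\<Prod>v\<in>V. if v = fst e \<or> v = snd e then ?s v else 1)"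
      using * ij by simp
  qed
  also have "\<dots> = (\<Prod>v\<in>V. \<Prod>e\<in>F. if v = fst e \<or> v = snd e then ?s v else 1)"
    by (rule prod.swap)
  also have "\<dots> = (\<Prod>v\<in>V. ?s v ^ degree_in F v)"
    using assms(1) by (simp add: prod.inter_filter[symmetric] degree_in_def)
  finally show ?thesis .
qed

text \<open>Regrouped by vertex, the integrand is a product of functions of single coordinates, so
  the integral splits into one moment of \<open>half_sign\<close> per vertex. A single odd degree
  makes it vanish.\<close>

lemma
  fixes V :: "nat set"
  assumes "finite F" "finite V" "\<And>i j. (i, j) \<in> F \<Longrightarrow> i \<in> V \<and> j \<in> V \<and> i \<noteq> j"
  defines "M \<equiv> Pi\<^sub>M V (\<lambda>_. restrict_space lborel {0..1})"
  shows integral_prod_half_sign_edges: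
      "(\<integral>x. (\<Prod>(i, j)\<in>F. half_sign (x i) * half_sign (x j)) \<partial>M) = of_bool (even_edge_set V F)"
    and integrable_prod_half_sign_edges:
      "integrable M (\<lambda>x. \<Prod>(i, j)\<in>F. half_sign (x i) * half_sign (x j))"
proof -
  interpret prob_space "restrict_space lborel {0..1::real}" by (rule prob_space_unit_interval)
  interpret product_sigma_finite "\<lambda>_::nat. restrict_space lborel {0..1::real}" ..
  have "(\<integral>x. (\<Prod>v\<in>V. half_sign (x v) ^ degree_in F v) \<partial>M)
      = (\<Prod>v\<in>V. if even (degree_in F v) then 1 else 0)"
    unfolding M_def
    by (subst product_integral_prod)
       (use assms(2) in \<open>auto simp: integral_half_sign_power integrable_half_sign_power\<close>)
  also have "\<dots> = of_bool (even_edge_set V F)"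
    using assms(2) by (auto simp: even_edge_set_def)
  finally show "(\<integral>x. (\<Prod>(i, j)\<in>F. half_sign (x i) * half_sign (x j)) \<partial>M)
      = of_bool (even_edge_set V F)"
    using prod_half_sign_edges[OF assms(1-3)] by simp
  show "integrable M (\<lambda>x. \<Prod>(i, j)\<in>F. half_sign (x i) * half_sign (x j))"
  proof -
    have "(\<lambda>x. \<Prod>(i, j)\<in>F. half_sign (x i) * half_sign (x j))
        = (\<lambda>x. \<Prod>v\<in>V. half_sign (x v) ^ degree_in F v)"
      using prod_half_sign_edges[OF assms(1-3)] by (intro ext) auto
    then show ?thesis
      unfolding M_def using assms(2) integrable_half_sign_power
      by (simp add: product_integrable_prod[where f = "\<lambda>v y. half_sign y ^ degree_in F v"])
  qed
qed

text \<open>When the product over the edges is multiplied out, \<open>F\<close> collects the edges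
  that supply the perturbation; the remaining edges supply the constant \<open>p\<close>.\<close>

lemma hom_density_block_kernel:
  assumes "simple_graph H"
  shows "hom_density H (block_kernel p c) =
    (\<Sum>F\<in>Pow (edge_pairs H).
       of_bool (even_edge_set (verts H) F) * (c ^ card F * p ^ (num_edges H - card F)))"
proof -
  define M :: "(nat \<Rightarrow> real) measure" where "M = Pi\<^sub>M (verts H) (\<lambda>_. restrict_space lborel {0..1})"
  let ?E = "edge_pairs H"
  let ?s = "\<lambda>x F. \<Prod>(i, j)\<in>F. half_sign (x i) * half_sign (x j)"
  let ?c = "\<lambda>F. c ^ card F * p ^ (num_edges H - card F)"
  note fin = finite_edge_pairs[OF assms]
  have finV: "finite (verts H)" by (simp add: verts_def)
  have expand: "(\<Prod>(i, j)\<in>?E. block_kernel p c (x i, x j)) = (\<Sum>F\<in>Pow ?E. ?s x F * ?c F)" for x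
  proof -
    have "(\<Prod>(i, j)\<in>?E. block_kernel p c (x i, x j))
        = (\<Prod>e\<in>?E. c * (half_sign (x (fst e)) * half_sign (x (snd e))) + p)"
      by (simp add: block_kernel_def case_prod_beta add.commute)
    also have "\<dots> = (\<Sum>F\<in>Pow ?E. (\<Prod>e\<in>F. c * (half_sign (x (fst e)) * half_sign (x (snd e))))
        * (\<Prod>e\<in>?E - F. p))"
      by (rule prod_add[OF fin])
    also have "\<dots> = (\<Sum>F\<in>Pow ?E. ?s x F * ?c F)"
    proof (rule sum.cong[OF refl])
      fix F assume "F \<in> Pow ?E"
      then have "card (?E - F) = num_edges H - card F"
        using fin card_edge_pairs[OF assms] by (simp add: card_Diff_subset finite_subset)
      then show "(\<Prod>e\<in>F. c * (half_sign (x (fst e)) * half_sign (x (snd e)))) * (\<Prod>e\<in>?E - F. p)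
          = ?s x F * ?c F"
        by (simp add: prod.distrib case_prod_beta)
    qed
    finally show ?thesis .
  qed
  have F: "finite F" "\<And>i j. (i, j) \<in> F \<Longrightarrow> i \<in> verts H \<and> j \<in> verts H \<and> i \<noteq> j"
    if "F \<in> Pow ?E" for F
    using that fin edge_pairs_verts[OF assms] by (auto simp: finite_subset) blast+
  have int: "integrable M (\<lambda>x. ?s x F)" if "F \<in> Pow ?E" for F
    unfolding M_def using F[OF that] finV by (intro integrable_prod_half_sign_edges) auto
  have "hom_density H (block_kernel p c)
      = (\<integral>x. (\<Sum>F\<in>Pow ?E. ?s x F * ?c F) \<partial>completion M)"
    unfolding hom_density_def cube_measure_def edge_pairs_def[symmetric] expand M_def ..
  \<comment> \<open>The integrand is already measurable for the bare product measure, so completing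
    the measure leaves the integral unchanged.\<close>
  also have "\<dots> = (\<integral>x. (\<Sum>F\<in>Pow ?E. ?s x F * ?c F) \<partial>M)"
    using int by (intro integral_completion borel_measurable_sum borel_measurable_times
        borel_measurable_const borel_measurable_integrable) auto
  also have "\<dots> = (\<Sum>F\<in>Pow ?E. (\<integral>x. ?s x F \<partial>M) * ?c F)"
    using int by (subst Bochner_Integration.integral_sum) auto
  also have "\<dots> = (\<Sum>F\<in>Pow ?E. of_bool (even_edge_set (verts H) F) * ?c F)"
    unfolding M_def using F finV
    by (intro sum.cong refl arg_cong2[where f = "(*)"] integral_prod_half_sign_edges) auto
  finally show ?thesis .
qed

text \<open>The only nonempty edge set is the single edge, where vertex 1 has degree one, so the
  perturbation integrates to zero.\<close>

lemma hom_density_complete_graph_2: "hom_density (complete_graph 2) (block_kernel p c) = p"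
proof -
  let ?K = "complete_graph 2"
  have simple: "simple_graph ?K"
    by (auto simp: simple_graph_def complete_graph_def verts_def)
  have E: "edge_pairs ?K = {(1, 2)}"
    by (auto simp: edge_pairs_def complete_graph_def)
  then have n: "num_edges ?K = 1" using card_edge_pairs[OF simple] by simp
  have "degree_in {(1, 2)} 1 = 1"
    by (simp add: degree_in_def)
       (rule card_1_singleton_iff[THEN iffD2, simplified], rule exI[of _ "(1, 2)"], auto)
  then have "\<not> even_edge_set (verts ?K) {(1, 2)}"
    by (auto simp: even_edge_set_def verts_def complete_graph_def intro!: bexI[of _ 1])
  moreover have "even_edge_set (verts ?K) {}" by (simp add: even_edge_set_def degree_in_def)
  ultimately show ?thesis
    unfolding hom_density_block_kernel[OF simple] E n by (simp add: Pow_insert)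
qed

lemma kernel_block_kernel: "kernel (block_kernel p c)"
proof -
  have "\<bar>block_kernel p c z\<bar> \<le> \<bar>p\<bar> + \<bar>c\<bar>" for z
    using abs_triangle_ineq[of p "c * (half_sign (fst z) * half_sign (snd z))"]
    by (simp add: block_kernel_def abs_mult abs_half_sign)
  then have "bounded (block_kernel p c ` ({0..1} \<times> {0..1}))"
    by (intro boundedI[of _ "\<bar>p\<bar> + \<bar>c\<bar>"]) auto
  moreover have "block_kernel p c \<in> borel_measurable (borel \<Otimes>\<^sub>M borel)"
    unfolding block_kernel_def by measurable
  then have "block_kernel p c \<in> borel_measurable (lebesgue_on ({0..1} \<times> {0..1}))"
    by (intro measurable_restrict_space1 measurable_completion) (simp add: borel_prod)
  ultimately show ?thesis by (auto simp: kernel_def block_kernel_def)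
qed

section \<open>Small even edge sets\<close>

text \<open>No vertex has degree one in \<open>F\<close>, so an edge of \<open>F\<close> is met by a
  second edge at each of its endpoints, and these two differ.\<close>

lemma even_edge_set_card_ge_3:
  assumes "finite F" "F \<noteq> {}" "even_edge_set V F"
    and F: "\<And>i j. (i, j) \<in> F \<Longrightarrow> i \<in> V \<and> j \<in> V \<and> i < j"
  shows "card F \<ge> 3"
proof -
  have other: "\<exists>e'\<in>F. e' \<noteq> e \<and> (v = fst e' \<or> v = snd e')"
    if "e \<in> F" "v \<in> V" "v = fst e \<or> v = snd e" for e v
  proof (rule ccontr)
    assume "\<not> ?thesis"
    then have "{e \<in> F. v = fst e \<or> v = snd e} = {e}" using that by auto
    then have "degree_in F v = 1" by (simp add: degree_in_def)
    with assms(3) that(2) show False by (auto simp: even_edge_set_def)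
  qed
  obtain i j where ij: "(i, j) \<in> F" using assms(2) by force
  obtain e where e: "e \<in> F" "e \<noteq> (i, j)" "i = fst e \<or> i = snd e"
    using other[OF ij, of i] F[OF ij] by auto
  obtain e' where e': "e' \<in> F" "e' \<noteq> (i, j)" "j = fst e' \<or> j = snd e'"
    using other[OF ij, of j] F[OF ij] by auto
  \<comment> \<open>A common edge would contain both \<open>i\<close> and \<open>j\<close>; with the
    smaller endpoint first it would be \<open>(i, j)\<close> itself.\<close>
  have "e \<noteq> e'"
    using e e' F[OF ij] F[of "fst e" "snd e"] by (cases e; cases e') auto
  then have "card {(i, j), e, e'} = 3" using e(2) e'(2) by auto
  moreover have "card {(i, j), e, e'} \<le> card F"
    using ij e(1) e'(1) assms(1) by (intro card_mono) auto
  ultimately show ?thesis by simp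
qed

lemma triangle_even_edge_set:
  assumes "subgraph_of (complete_graph 3) H"
  obtains T where "T \<subseteq> edge_pairs H" "card T = 3" "even_edge_set V T"
proof -
  obtain \<phi> where \<phi>: "inj_on \<phi> {1..3::nat}"
      "\<And>f. f \<subseteq> {1..3} \<Longrightarrow> card f = 2 \<Longrightarrow> \<phi> ` f \<in> edges H"
    using assms unfolding subgraph_of_def complete_graph_def verts_def by auto
  have edge: "{\<phi> i, \<phi> j} \<in> edges H" "\<phi> i \<noteq> \<phi> j" if "i \<in> {1..3}" "j \<in> {1..3}" "i \<noteq> j" for i j
    using \<phi>(2)[of "{i, j}"] inj_onD[OF \<phi>(1)] that by auto
  define x y z where "x = \<phi> 1" and "y = \<phi> 2" and "z = \<phi> 3"
  have xyz: "{x, y} \<in> edges H" "{x, z} \<in> edges H" "{y, z} \<in> edges H" "x \<noteq> y" "x \<noteq> z" "y \<noteq> z"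
    unfolding x_def y_def z_def by (intro edge; simp)+
  \<comment> \<open>The embedding need not preserve order, so the images of the triangle's vertices
    are sorted; the cases are their six possible orders.\<close>
  obtain a b c where abc: "a < b" "b < c" "{a, b} \<in> edges H" "{a, c} \<in> edges H" "{b, c} \<in> edges H"
  proof -
    consider "x < y" "y < z" | "x < z" "z < y" | "y < x" "x < z" | "y < z" "z < x"
      | "z < x" "x < y" | "z < y" "y < x"
      using xyz by linarith
    then show thesis
      by cases (use that xyz in \<open>auto simp: insert_commute\<close>)
  qed
  define T where "T = {(a, b), (a, c), (b, c)}"
  have "even (degree_in T v)" for v
  proof -
    have "{e \<in> T. v = fst e \<or> v = snd e} =
        (if v = a then {(a, b), (a, c)} else if v = b then {(a, b), (b, c)}
         else if v = c then {(a, c), (b, c)} else {})"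
      using abc by (auto simp: T_def)
    then show ?thesis using abc by (simp add: degree_in_def)
  qed
  then have "even_edge_set V T" by (simp add: even_edge_set_def)
  moreover have "T \<subseteq> edge_pairs H" using abc by (auto simp: T_def edge_pairs_def)
  moreover have "card T = 3" using abc by (simp add: T_def)
  ultimately show thesis using that by blast
qed

section \<open>Choice of the perturbation and comparison of the two sides\<close>

theorem theorem1p1:
  fixes H :: graph
  assumes "simple_graph H"
    and "subgraph_of (complete_graph 3) H"
    and "num_edges H > 3"
  shows "\<not> strongly_common H"
proof
  assume sc: "strongly_common H"
  define n where "n = num_edges H"
  \<comment> \<open>A triangle will contribute \<open>- (c ^ 3 * d)\<close> to the sum of the two
    densities; \<open>n > 3\<close> makes \<open>d\<close> positive.\<close>
  define d :: real where "d = (3/4) ^ (n - 3) - (1/4) ^ (n - 3)"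
  \<comment> \<open>Small enough that at most \<open>2 ^ n\<close> error terms of size
    \<open>2 * c ^ 4\<close> add up to only half of \<open>c ^ 3 * d\<close>.\<close>
  define c :: real where "c = d / 2 ^ (n + 2)"
  have d: "0 < d" "d \<le> 1"
    using assms(3) power_strict_mono[of "1/4::real" "3/4" "n - 3"] power_le_one[of "3/4::real" "n - 3"]
      zero_le_power[of "1/4::real" "n - 3"]
    by (simp_all add: d_def n_def del: zero_le_power)
  have c_mult: "c * 2 ^ (n + 2) = d" by (simp add: c_def)
  have "(1::real) \<le> 2 ^ n" by simp
  then have "d \<le> 2 ^ n" using d by linarith
  \<comment> \<open>The bound 1/4 keeps the values \<open>1/4 + c\<close> and \<open>1/4 - c\<close>
    of the kernel inside [0,1].\<close>
  then have c: "0 < c" "c \<le> 1/4"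
    using d by (simp_all add: c_def divide_simps)
  let ?W = "block_kernel (1/4) c"
  let ?P = "Pow (edge_pairs H)"
  let ?ev = "\<lambda>F. of_bool (even_edge_set (verts H) F) :: real"
  \<comment> \<open>The joint contribution of \<open>F\<close> to the densities of the kernel and of
    its complement. For empty \<open>F\<close> it is exactly the right side of the
    inequality.\<close>
  define a where "a F = ?ev F * (c ^ card F * (1/4) ^ (n - card F))
    + ?ev F * ((- c) ^ card F * (3/4) ^ (n - card F))" for F
  have compl: "(\<lambda>z. 1 - ?W z) = block_kernel (3/4) (- c)"
    by (simp add: block_kernel_def fun_eq_iff)
  have "?W z \<in> {0..1}" for z
    using c by (auto simp: block_kernel_def half_sign_def)
  then have "hom_density H ?W + hom_density H (\<lambda>z. 1 - ?W z)
      \<ge> hom_density (complete_graph 2) ?W ^ n + hom_density (complete_graph 2) (\<lambda>z. 1 - ?W z) ^ n"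
    using sc kernel_block_kernel unfolding strongly_common_def n_def by blast
  then have ge: "sum a ?P \<ge> (1/4) ^ n + (3/4) ^ n"
    unfolding compl hom_density_complete_graph_2 hom_density_block_kernel[OF assms(1)]
    by (simp add: a_def sum.distrib n_def)
  have finE: "finite (edge_pairs H)" by (rule finite_edge_pairs[OF assms(1)])
  have a_empty: "a {} = (1/4) ^ n + (3/4) ^ n"
    by (simp add: a_def even_edge_set_def degree_in_def)
  obtain T where T: "T \<subseteq> edge_pairs H" "card T = 3" "even_edge_set (verts H) T"
    using triangle_even_edge_set[OF assms(2)] .
  \<comment> \<open>The odd exponent makes the complement's term negative, and its weight
    \<open>(3/4) ^ (n - 3)\<close> outweighs \<open>(1/4) ^ (n - 3)\<close>.\<close>
  have a_3: "a F = - (?ev F * (c ^ 3 * d))" if "card F = 3" for F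
    using that by (simp add: a_def d_def algebra_simps power3_eq_cube)
  have a_le: "a F \<le> 2 * c ^ 4" if F: "F \<subseteq> edge_pairs H" "F \<noteq> {}" for F
  proof (cases "even_edge_set (verts H) F")
    case True
    have "card F \<ge> 3"
      using F edge_pairs_verts[OF assms(1)] finE True
      by (intro even_edge_set_card_ge_3[of F "verts H"]) (auto simp: finite_subset)
    then consider "card F = 3" | "card F \<ge> 4" by linarith
    then show ?thesis
    proof cases
      case 1
      have "0 \<le> c ^ 3 * d" "0 \<le> c ^ 4" using c d by simp_all
      moreover have "a F = - (c ^ 3 * d)" using a_3[OF 1] True by simp
      ultimately show ?thesis by linarith
    next
      case 2
      \<comment> \<open>Stated for general \<open>x\<close> and \<open>p\<close> so that it bounds
        both summands of \<open>a F\<close>; as \<open>c\<close> is at most 1, exponents above 4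
        only shrink the power.\<close>
      have "(\<bar>x\<bar> ^ card F) * p ^ m \<le> c ^ 4 * 1" if "\<bar>x\<bar> = c" "0 \<le> p" "p \<le> 1" for x p :: real and m
        using that c 2 by (intro mult_mono power_decreasing power_le_one) auto
      then have "\<bar>x ^ card F * p ^ m\<bar> \<le> c ^ 4" if "\<bar>x\<bar> = c" "0 \<le> p" "p \<le> 1" for x p :: real and m
        using that by (simp add: abs_mult power_abs)
      from this[of c "1/4" "n - card F"] this[of "- c" "3/4" "n - card F"] show ?thesis
        using c(1) by (simp add: a_def True)
    qed
  qed (use c in \<open>simp add: a_def\<close>)
  have "T \<in> ?P - {{}}" using T by auto
  \<comment> \<open>The empty set gives the right side and \<open>T\<close> the decrease; all other
    sets, further triangles included, are covered by \<open>a_le\<close>.\<close>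
  then have "sum a ?P = a {} + (a T + sum a (?P - {{}} - {T}))"
    using finE by (simp add: sum.remove[of ?P "{}"] sum.remove[of "?P - {{}}" T])
  moreover have "sum a (?P - {{}} - {T}) \<le> real (card (?P - {{}} - {T})) * (2 * c ^ 4)"
    by (rule sum_bounded_above) (use a_le in auto)
  moreover have "real (card (?P - {{}} - {T})) * (2 * c ^ 4) \<le> 2 ^ n * (2 * c ^ 4)"
  proof (rule mult_right_mono)
    have "card (?P - {{}} - {T}) \<le> card ?P"
      using finE by (intro card_mono) auto
    also have "\<dots> = 2 ^ n"
      using finE by (simp add: card_Pow card_edge_pairs[OF assms(1)] n_def)
    finally show "real (card (?P - {{}} - {T})) \<le> 2 ^ n"
      by (metis of_nat_le_iff of_nat_numeral of_nat_power)
  qed (use c in simp)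
  moreover have "2 ^ n * (2 * c ^ 4) < c ^ 3 * d"
  proof -
    have "c ^ 3 * d = 2 * (2 ^ n * (2 * c ^ 4))"
      unfolding c_mult[symmetric] by (simp add: power_add eval_nat_numeral power3_eq_cube)
    moreover have "0 < 2 ^ n * (2 * c ^ 4)" using c by simp
    ultimately show ?thesis by linarith
  qed
  ultimately show False
    using ge a_empty a_3[OF T(2)] T(3) by simp
qed

end
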